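(* Let $d,s\ge 1$ and $n\ge 2$ be integers with $s\le \binom{\lfloor d/2\rfloor+n-1}{n-1}$. Let $F_s=\ell_1^d+\cdots+\ell_s^d\in \mathbb{K}[X_1,\dots,X_n]$, where $\ell_1,\dots,\ell_s$ are general linear forms in $\mathbb{K}[X_1,\dots,X_n]$. Then the Waring rank of $F_s$ is $Wr(F_s)=s$.
   Context: $\mathbb{K}$ is an algebraically closed field of characteristic zero. The Waring rank $Wr(f)$ of a nonzero homogeneous polynomial $f$ of degree $d$ is the minimum number of terms in an expression of $f$ as a linear combination of $d$-th powers of linear forms; that is, the least $r$ such that $f=\sum_{i=1}^{r}L_i^d$ for some linear forms $L_i$. "General": writing $\ell_i=a_{i,1}X_1+\cdots+a_{i,n}X_n$, a statement holds for general linear forms $\ell_1,\dots,\ell_s$ if there is a nonempty (dense) Zariski open subset $U\subset \mathbb{K}^{ns}$ such that it holds whenever $(a_{1,1},\dots,a_{1,n},\dots,a_{s,1},\dots,a_{s,n})\in U$. *)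

theory Defs
  imports
    "HOL-Library.Poly_Mapping"
    "HOL-Library.FuncSet"
    "HOL-Computational_Algebra.Computational_Algebra"
begin

section \<open>Multivariate polynomials\<close>

text \<open>
  A monomial is a finitely supported exponent vector, a polynomial a finitely supported
  map from monomials to coefficients. The ring structure is the convolution product
  provided by \<^theory>\<open>HOL-Library.Poly_Mapping\<close>.
\<close>

type_synonym ('v, 'a) mpoly = "('v \<Rightarrow>\<^sub>0 nat) \<Rightarrow>\<^sub>0 'a"

definition Const :: "'a::zero \<Rightarrow> ('v, 'a) mpoly" where
  "Const c = Poly_Mapping.single 0 c"

definition Var :: "'v \<Rightarrow> ('v, 'a::zero_neq_one) mpoly" where
  "Var v = Poly_Mapping.single (Poly_Mapping.single v 1) 1"

definition mpolys_in :: "'v set \<Rightarrow> ('v, 'a::zero) mpoly set" where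
  "mpolys_in I = {p. \<forall>m \<in> Poly_Mapping.keys p. Poly_Mapping.keys m \<subseteq> I}"

definition eval_mpoly :: "('v \<Rightarrow> 'a::comm_semiring_1) \<Rightarrow> ('v, 'a) mpoly \<Rightarrow> 'a" where
  "eval_mpoly x p =
    (\<Sum>m \<in> Poly_Mapping.keys p. Poly_Mapping.lookup p m *
       (\<Prod>v \<in> Poly_Mapping.keys m. x v ^ Poly_Mapping.lookup m v))"


section \<open>Zariski topology on affine space and general points\<close>

text \<open>
  Points of the affine space with coordinates indexed by a finite set \<open>I\<close> are the
  functions on \<open>I\<close>, extended by \<^const>\<open>undefined\<close> outside \<open>I\<close>.
\<close>

definition affine_space :: "'v set \<Rightarrow> ('v \<Rightarrow> 'a) set" where
  "affine_space I = I \<rightarrow>\<^sub>E UNIV"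

definition zariski_closed :: "'v set \<Rightarrow> ('v \<Rightarrow> 'a::comm_semiring_1) set \<Rightarrow> bool" where
  "zariski_closed I Z \<longleftrightarrow>
    (\<exists>P \<subseteq> mpolys_in I. Z = {x \<in> affine_space I. \<forall>p \<in> P. eval_mpoly x p = 0})"

definition zariski_open :: "'v set \<Rightarrow> ('v \<Rightarrow> 'a::comm_semiring_1) set \<Rightarrow> bool" where
  "zariski_open I U \<longleftrightarrow> U \<subseteq> affine_space I \<and> zariski_closed I (affine_space I - U)"

text \<open>
  Density of \<open>U\<close> is not demanded separately: over an infinite field every nonempty
  Zariski open subset of affine space is dense.
\<close>

definition holds_for_general ::
    "'v set \<Rightarrow> (('v \<Rightarrow> 'a::comm_semiring_1) \<Rightarrow> bool) \<Rightarrow> bool" where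
  "holds_for_general I Q \<longleftrightarrow> (\<exists>U. zariski_open I U \<and> U \<noteq> {} \<and> (\<forall>a \<in> U. Q a))"


section \<open>Linear forms and Waring rank\<close>

definition linear_form :: "nat \<Rightarrow> (nat \<Rightarrow> 'a::comm_ring_1) \<Rightarrow> (nat, 'a) mpoly" where
  "linear_form n c = (\<Sum>j = 1..n. Const (c j) * Var j)"

definition linear_forms :: "nat \<Rightarrow> (nat, 'a::comm_ring_1) mpoly set" where
  "linear_forms n = {L. \<exists>c. L = linear_form n c}"

text \<open>
  The Waring rank of a form \<open>f\<close> of degree \<open>d\<close> in the variables indexed by \<open>1, \<dots>, n\<close>.
  The value is unspecified if \<open>f\<close> is not a sum of \<open>d\<close>-th powers of linear forms.
\<close>

definition waring_rank :: "nat \<Rightarrow> nat \<Rightarrow> (nat, 'a::comm_ring_1) mpoly \<Rightarrow> nat" where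
  "waring_rank n d f =
    (LEAST r. \<exists>L. (\<forall>i \<in> {1..r}. L i \<in> linear_forms n) \<and> f = (\<Sum>i = 1..r. L i ^ d))"

end

theory Submission
  imports Defs "Jordan_Normal_Form.Determinant"
begin

text \<open>
  The lower bound on the rank comes from catalecticant matrices. The coefficient of
  \<open>X\<^sup>m\<close>, with \<open>m\<close> of total degree \<open>d\<close>, in a sum of powers
  \<open>L\<^sub>1\<^sup>d + \<dots> + L\<^sub>r\<^sup>d\<close> is a nonzero integer depending only on \<open>m\<close> times the power
  sum \<open>\<Sum>i. c\<^sub>i\<^sup>m\<close>, where \<open>c\<^sub>i\<close> is the coefficient vector of \<open>L\<^sub>i\<close>
  (\<open>lookup_linear_form_power\<close>). In characteristic zero the polynomial therefore determines
  all these power sums. Splitting \<open>d = k + l\<close>, with exponents \<open>\<alpha>\<^sub>p\<close> of degree \<open>k\<close> and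
  \<open>\<beta>\<^sub>q\<close> of degree \<open>l\<close>, the matrix with entries
  \<open>\<Sum>i. c\<^sub>i\<^sup>m\<close>, \<open>m = \<alpha>\<^sub>p + \<beta>\<^sub>q\<close>, is a sum of \<open>r\<close> matrices of rank at most one.
  An \<open>s\<close> by \<open>s\<close> minor that does not vanish thus excludes every expression with fewer than
  \<open>s\<close> powers (\<open>waring_rank_eq_if_catalecticant_det_nonzero\<close>).

  For the given expression \<open>\<ell>\<^sub>1\<^sup>d + \<dots> + \<ell>\<^sub>s\<^sup>d\<close> such a minor is a polynomial in the
  coefficients of the \<open>\<ell>\<^sub>i\<close>, so its nonvanishing is a Zariski open condition, and only one
  point satisfying it has to be found. Take \<open>k = \<lfloor>d/2\<rfloor>\<close> and \<open>l = d - k\<close>. The bound on \<open>s\<close> says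
  precisely that there are \<open>s\<close> distinct exponents \<open>\<alpha>\<^sub>p\<close> of degree \<open>k\<close>
  (\<open>obtain_exponents\<close>); multiplying the corresponding monomials by a power of \<open>X\<^sub>1\<close> gives
  \<open>s\<close> distinct \<open>\<beta>\<^sub>q\<close> of degree \<open>l\<close>. The minor factors as the product of the determinants of
  \<open>(c\<^sub>i\<^sup>m)\<close> with \<open>m = \<alpha>\<^sub>p\<close> and with \<open>m = \<beta>\<^sub>p\<close> (\<open>det_catalecticant_power_sums\<close>).
  If \<open>c\<^sub>i\<close> is the coordinatewise \<open>(i-1)\<close>-st power of a fixed vector \<open>y\<close> at which different
  monomials of degree at most \<open>d\<close> take different values, both factors are Vandermonde
  determinants with distinct nodes, hence nonzero. Coordinates \<open>y\<^sub>j\<close> that are powers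
  of \<open>2\<close> with exponents \<open>(d+1)\<^bsup>j-1\<^esup>\<close> have this property, by uniqueness of expansions in
  base \<open>d + 1\<close>.
\<close>

section \<open>Evaluation is a ring homomorphism\<close>

definition monomial_value :: "('v \<Rightarrow> 'a::comm_semiring_1) \<Rightarrow> ('v \<Rightarrow>\<^sub>0 nat) \<Rightarrow> 'a" where
  "monomial_value x m =
    (\<Prod>v \<in> Poly_Mapping.keys m. x v ^ Poly_Mapping.lookup m v)"

text \<open>
  Two monomials with different supports can only be compared after both products are taken
  over a common index set.
\<close>

lemma monomial_value_superset:
  assumes "finite A" "Poly_Mapping.keys m \<subseteq> A"
  shows "monomial_value x m = (\<Prod>v \<in> A. x v ^ Poly_Mapping.lookup m v)"
  unfolding monomial_value_def
  by (rule prod.mono_neutral_left) (use assms in \<open>auto simp: in_keys_iff\<close>)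

lemma monomial_value_add:
  "monomial_value x (m + m') = monomial_value x m * monomial_value x m'"
proof -
  let ?A = "Poly_Mapping.keys m \<union> Poly_Mapping.keys m'"
  have "Poly_Mapping.keys (m + m') \<subseteq> ?A"
    by (rule Poly_Mapping.keys_add)
  then show ?thesis
    by (simp add: monomial_value_superset[of ?A] lookup_add power_add prod.distrib)
qed

lemma eval_mpoly_conv_monomial_value:
  "eval_mpoly x p =
    (\<Sum>m \<in> Poly_Mapping.keys p. Poly_Mapping.lookup p m * monomial_value x m)"
  by (simp add: eval_mpoly_def monomial_value_def)

lemma eval_mpoly_add: "eval_mpoly x (p + q) = eval_mpoly x p + eval_mpoly x q"
  unfolding eval_mpoly_conv_monomial_value
  by (rule setsum_keys_plus_distrib) (simp_all add: distrib_right)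

lemma eval_mpoly_single:
  "eval_mpoly x (Poly_Mapping.single m c) = c * monomial_value x m"
  by (simp add: eval_mpoly_conv_monomial_value)

lemma eval_mpoly_zero: "eval_mpoly x 0 = 0"
  by (simp add: eval_mpoly_def)

lemma mpoly_induct [case_names zero add_monomial]:
  fixes p :: "('v, 'a::comm_monoid_add) mpoly"
  assumes "P 0" and "\<And>m c p. P p \<Longrightarrow> P (Poly_Mapping.single m c + p)"
  shows "P p"
proof (induction p rule: update_induct)
  case const
  then show ?case by (rule assms(1))
next
  case (update f m c)
  have "Poly_Mapping.update m c f = Poly_Mapping.single m c + f"
    using update.hyps
    by (intro poly_mapping_eqI)
      (auto simp: lookup_update lookup_add lookup_single when_def in_keys_iff)
  then show ?case using assms(2)[OF update.IH] by simp
qed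

lemma eval_mpoly_mult: "eval_mpoly x (p * q) = eval_mpoly x p * eval_mpoly x q"
proof -
  have monomial: "eval_mpoly x (Poly_Mapping.single m c * q) = c * monomial_value x m * eval_mpoly x q"
    for m c
  proof (induction q rule: mpoly_induct)
    case zero
    then show ?case by (simp add: eval_mpoly_zero)
  next
    case (add_monomial m' c' q)
    then show ?case
      by (simp add: distrib_left eval_mpoly_add mult_single eval_mpoly_single
          monomial_value_add mult_ac)
  qed
  show ?thesis
    by (induction p rule: mpoly_induct)
      (simp_all add: eval_mpoly_zero distrib_right eval_mpoly_add monomial eval_mpoly_single)
qed

lemma eval_mpoly_hom:
  "comm_ring_hom (eval_mpoly x :: ('v, 'a::comm_ring_1) mpoly \<Rightarrow> 'a)"
proof
  show "eval_mpoly x 1 = (1 :: 'a)"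
    using eval_mpoly_single[of x 0 1] by (simp add: monomial_value_def)
qed (simp_all add: eval_mpoly_zero eval_mpoly_add eval_mpoly_mult)

lemma eval_mpoly_Var: "eval_mpoly x (Var v) = x v"
  by (simp add: Var_def eval_mpoly_single monomial_value_def)

lemma mpolys_in_0: "0 \<in> mpolys_in I"
  by (simp add: mpolys_in_def)

lemma mpolys_in_1: "1 \<in> mpolys_in I"
  by (simp add: mpolys_in_def)

lemma mpolys_in_add: "p \<in> mpolys_in I \<Longrightarrow> q \<in> mpolys_in I \<Longrightarrow> p + q \<in> mpolys_in I"
  using Poly_Mapping.keys_add[of p q] by (auto simp: mpolys_in_def)

lemma mpolys_in_uminus: 
  fixes p :: "('v, 'a::ab_group_add) mpoly"
  shows "p \<in> mpolys_in I \<Longrightarrow> - p \<in> mpolys_in I"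
  by (simp add: mpolys_in_def in_keys_iff)

lemma mpolys_in_mult:
  assumes "p \<in> mpolys_in I" "q \<in> mpolys_in I"
  shows "p * q \<in> mpolys_in I"
  unfolding mpolys_in_def
proof (intro CollectI ballI)
  fix m assume "m \<in> Poly_Mapping.keys (p * q)"
  then obtain a b where "m = a + b" "a \<in> Poly_Mapping.keys p" "b \<in> Poly_Mapping.keys q"
    using Poly_Mapping.keys_mult[of p q] by blast
  then show "Poly_Mapping.keys m \<subseteq> I"
    using assms Poly_Mapping.keys_add[of a b] by (fastforce simp: mpolys_in_def)
qed

lemma mpolys_in_sum: "(\<And>i. i \<in> A \<Longrightarrow> f i \<in> mpolys_in I) \<Longrightarrow> sum f A \<in> mpolys_in I"
  by (induction A rule: infinite_finite_induct) (auto intro: mpolys_in_0 mpolys_in_add)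

lemma mpolys_in_prod: "(\<And>i. i \<in> A \<Longrightarrow> f i \<in> mpolys_in I) \<Longrightarrow> prod f A \<in> mpolys_in I"
  by (induction A rule: infinite_finite_induct) (auto intro: mpolys_in_1 mpolys_in_mult)

lemma mpolys_in_power: "p \<in> mpolys_in I \<Longrightarrow> p ^ k \<in> mpolys_in I"
  by (induction k) (auto intro: mpolys_in_1 mpolys_in_mult)

lemma mpolys_in_Var: "v \<in> I \<Longrightarrow> Var v \<in> mpolys_in I"
  by (simp add: mpolys_in_def Var_def)

text \<open>
  The Leibniz formula builds a determinant from its entries by ring operations, so minors
  with polynomial entries can serve as equations of closed sets.
\<close>

lemma mpolys_in_det:
  fixes A :: "('v, 'a::comm_ring_1) mpoly mat"
  assumes A: "A \<in> carrier_mat k k"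
    and entries: "\<And>p q. p < k \<Longrightarrow> q < k \<Longrightarrow> A $$ (p, q) \<in> mpolys_in I"
  shows "det A \<in> mpolys_in I"
proof -
  have "signof \<pi> \<in> (mpolys_in I :: ('v, 'a) mpoly set)" for \<pi> :: "nat \<Rightarrow> nat"
    by (auto simp: sign_def intro: mpolys_in_1 mpolys_in_uminus)
  then show ?thesis
    unfolding det_def'[OF A]
    by (intro mpolys_in_sum mpolys_in_mult mpolys_in_prod entries)
      (auto simp: permutes_in_image)
qed

lemma zariski_open_nonvanishing:
  assumes "D \<in> mpolys_in I"
  shows "zariski_open I {x \<in> affine_space I. eval_mpoly x D \<noteq> 0}"
  unfolding zariski_open_def zariski_closed_def
proof (intro conjI exI)
  show "{D} \<subseteq> mpolys_in I" using assms by simp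
qed auto

section \<open>Coefficients of powers of linear forms\<close>

text \<open>
  The product ranges over all of \<open>{1..n}\<close> and ignores exponents outside it; this keeps it
  multiplicative in \<open>m\<close> and lets \<open>c\<close> be arbitrary outside \<open>{1..n}\<close>.
\<close>

definition form_monomial :: "nat \<Rightarrow> (nat \<Rightarrow> 'a::comm_semiring_1) \<Rightarrow> (nat \<Rightarrow>\<^sub>0 nat) \<Rightarrow> 'a" where
  "form_monomial n c m = (\<Prod>j = 1..n. c j ^ Poly_Mapping.lookup m j)"

lemma form_monomial_add:
  "form_monomial n c (m + m') = form_monomial n c m * form_monomial n c m'"
  by (simp add: form_monomial_def lookup_add power_add prod.distrib)

text \<open>
  The multinomial coefficient \<open>d! / \<Prod>j. m\<^sub>j!\<close> if \<open>m\<close> is an exponent of degree \<open>d\<close> in the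
  variables \<open>1, \<dots>, n\<close>, and \<open>0\<close> otherwise: it counts the words of length \<open>d\<close> over
  \<open>{1..n}\<close> that contain each letter \<open>j\<close> exactly \<open>m\<^sub>j\<close> times, by removing the first letter.
  The recursion mirrors multiplication by one more linear form.
\<close>

fun word_count :: "nat \<Rightarrow> nat \<Rightarrow> (nat \<Rightarrow>\<^sub>0 nat) \<Rightarrow> nat" where
  "word_count n 0 m = (if m = 0 then 1 else 0)"
| "word_count n (Suc d) m =
    (\<Sum>j \<in> {1..n} \<inter> Poly_Mapping.keys m. word_count n d (m - Poly_Mapping.single j 1))"

lemma diff_add_single:
  fixes m :: "'v \<Rightarrow>\<^sub>0 nat"
  assumes "j \<in> Poly_Mapping.keys m"
  shows "Poly_Mapping.single j 1 + (m - Poly_Mapping.single j 1) = m"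
  using assms
  by (intro poly_mapping_eqI)
    (auto simp: lookup_add lookup_minus lookup_single when_def in_keys_iff)

lemma lookup_single_mult:
  fixes p :: "('v, 'a::comm_semiring_1) mpoly"
  shows "Poly_Mapping.lookup (Poly_Mapping.single (Poly_Mapping.single j 1) c * p) m =
    (if j \<in> Poly_Mapping.keys m
     then c * Poly_Mapping.lookup p (m - Poly_Mapping.single j 1) else 0)"
proof -
  let ?e = "Poly_Mapping.single j (1::nat)"
  have "Poly_Mapping.lookup (Poly_Mapping.single ?e c * p) m =
      c * Sum_any (\<lambda>q. Poly_Mapping.lookup p q when m = ?e + q)"
    by (simp add: lookup_mult lookup_single when_mult)
  also have "\<dots> = (if j \<in> Poly_Mapping.keys m
     then c * Poly_Mapping.lookup p (m - ?e) else 0)"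
  proof (cases "j \<in> Poly_Mapping.keys m")
    case True
    have "m = ?e + q \<longleftrightarrow> q = m - ?e" for q
      using diff_add_single[OF True] by (metis add_left_cancel)
    then show ?thesis using True by simp
  next
    case False
    have "m \<noteq> ?e + q" for q
    proof
      assume "m = ?e + q"
      then have "Poly_Mapping.lookup m j = 1 + Poly_Mapping.lookup q j"
        by (simp add: lookup_add)
      with False show False by (simp add: in_keys_iff)
    qed
    then show ?thesis using False by simp
  qed
  finally show ?thesis .
qed

lemma linear_form_eq:
  "linear_form n c =
    (\<Sum>j = 1..n. Poly_Mapping.single (Poly_Mapping.single j 1) (c j))"
  by (simp add: linear_form_def Const_def Var_def mult_single)

text \<open>
  The multinomial theorem for linear forms. Multiplying \<open>L\<^sup>d\<close> by the summand \<open>c\<^sub>j X\<^sub>j\<close> of \<open>L\<close>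
  moves the coefficient at \<open>m - e\<^sub>j\<close> to \<open>m\<close>, and \<open>c\<^sub>j c\<^bsup>m - e\<^esup> = c\<^sup>m\<close> for \<open>e = e\<^sub>j\<close>, so the
  monomial in \<open>c\<close> factors out and only the count is left to sum.
\<close>

lemma lookup_linear_form_power:
  fixes c :: "nat \<Rightarrow> 'a::comm_ring_1"
  shows "Poly_Mapping.lookup (linear_form n c ^ d) m =
    of_nat (word_count n d m) * form_monomial n c m"
proof (induction d arbitrary: m)
  case 0
  then show ?case by (simp add: lookup_one form_monomial_def)
next
  case (Suc d)
  let ?e = "\<lambda>j. Poly_Mapping.single j (1::nat)"
  have "Poly_Mapping.lookup (linear_form n c ^ Suc d) m =
      (\<Sum>j = 1..n. if j \<in> Poly_Mapping.keys m
        then c j * Poly_Mapping.lookup (linear_form n c ^ d) (m - ?e j) else 0)"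
    unfolding power_Suc
    by (subst linear_form_eq) (unfold sum_distrib_right lookup_sum lookup_single_mult, rule refl)
  also have "\<dots> = (\<Sum>j \<in> {1..n} \<inter> Poly_Mapping.keys m.
      c j * Poly_Mapping.lookup (linear_form n c ^ d) (m - ?e j))"
    by (simp only: sum.inter_restrict finite_atLeastAtMost)
  also have "\<dots> = (\<Sum>j \<in> {1..n} \<inter> Poly_Mapping.keys m.
      of_nat (word_count n d (m - ?e j)) * form_monomial n c m)"
  proof (rule sum.cong[OF refl])
    fix j assume j: "j \<in> {1..n} \<inter> Poly_Mapping.keys m"
    have "form_monomial n c (?e j) = (\<Prod>i = 1..n. if i = j then c i else 1)"
      unfolding form_monomial_def by (intro prod.cong) (auto simp: lookup_single)
    also have "\<dots> = c j" using j by simp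
    finally have "form_monomial n c m = c j * form_monomial n c (m - ?e j)"
      using j form_monomial_add[of n c "?e j" "m - ?e j"] by (simp add: diff_add_single del: One_nat_def)
    then show "c j * Poly_Mapping.lookup (linear_form n c ^ d) (m - ?e j) =
        of_nat (word_count n d (m - ?e j)) * form_monomial n c m"
      by (simp add: Suc.IH mult_ac)
  qed
  also have "\<dots> = of_nat (word_count n (Suc d) m) * form_monomial n c m"
    by (simp add: sum_distrib_right)
  finally show ?case .
qed

definition exponents :: "nat \<Rightarrow> nat \<Rightarrow> (nat \<Rightarrow>\<^sub>0 nat) set" where
  "exponents n d = {m. Poly_Mapping.keys m \<subseteq> {1..n} \<and> (\<Sum>j = 1..n. Poly_Mapping.lookup m j) = d}"

lemma exponents_add:
  assumes "a \<in> exponents n k" "b \<in> exponents n l"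
  shows "a + b \<in> exponents n (k + l)"
  using assms Poly_Mapping.keys_add[of a b]
  by (auto simp: exponents_def lookup_add sum.distrib)

lemma word_count_pos:
  assumes "m \<in> exponents n d"
  shows "word_count n d m > 0"
  using assms
proof (induction d arbitrary: m)
  case 0
  have "Poly_Mapping.lookup m j = 0" for j
    using 0 by (cases "j \<in> {1..n}") (auto simp: exponents_def in_keys_iff)
  then have "m = 0" by (intro poly_mapping_eqI) simp
  then show ?case by simp
next
  case (Suc d)
  let ?e = "\<lambda>j. Poly_Mapping.single j (1::nat)"
  have "(\<Sum>j = 1..n. Poly_Mapping.lookup m j) \<noteq> 0"
    using Suc.prems by (simp add: exponents_def)
  then obtain j where j: "j \<in> {1..n}" "j \<in> Poly_Mapping.keys m"
    by (meson in_keys_iff sum.neutral)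
  have m: "?e j + (m - ?e j) = m" by (rule diff_add_single[OF j(2)])
  have "(\<Sum>i = 1..n. Poly_Mapping.lookup (?e j) i) = 1"
    using j(1) by (simp add: lookup_single when_def)
  moreover have "(\<Sum>i = 1..n. Poly_Mapping.lookup (?e j) i) +
      (\<Sum>i = 1..n. Poly_Mapping.lookup (m - ?e j) i) = Suc d"
    using Suc.prems
    by (subst (asm) m[symmetric]) (simp add: exponents_def lookup_add sum.distrib)
  moreover have "Poly_Mapping.keys (m - ?e j) \<subseteq> {1..n}"
    using Suc.prems by (auto simp: exponents_def lookup_minus in_keys_iff subset_iff)
  ultimately have "m - ?e j \<in> exponents n d"
    by (simp add: exponents_def)
  then have "word_count n d (m - ?e j) > 0" by (rule Suc.IH)
  then show ?case
    using j by (auto intro!: sum_pos2[where i = j])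
qed

text \<open>
  This is where characteristic zero enters: the multinomial coefficient, a positive integer,
  can be cancelled.
\<close>

lemma power_sums_eq_of_Waring_eq:
  fixes b c :: "nat \<Rightarrow> nat \<Rightarrow> 'a::{field_char_0}"
  assumes eq: "(\<Sum>i = 1..r. linear_form n (b i) ^ d) = (\<Sum>i = 1..s. linear_form n (c i) ^ d)"
    and m: "m \<in> exponents n d"
  shows "(\<Sum>i = 1..r. form_monomial n (b i) m) = (\<Sum>i = 1..s. form_monomial n (c i) m)"
proof -
  have "of_nat (word_count n d m) * (\<Sum>i = 1..r. form_monomial n (b i) m) =
      of_nat (word_count n d m) * (\<Sum>i = 1..s. form_monomial n (c i) m)"
    using arg_cong[OF eq, of "\<lambda>p. Poly_Mapping.lookup p m"]
    by (simp add: lookup_sum lookup_linear_form_power sum_distrib_left)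
  then show ?thesis using word_count_pos[OF m] by simp
qed

section \<open>Catalecticant minors\<close>

text \<open>
  A sum of \<open>s\<close> outer products is the product of the transpose of the matrix with rows
  \<open>u\<^sub>1, \<dots>, u\<^sub>s\<close> and the matrix with rows \<open>v\<^sub>1, \<dots>, v\<^sub>s\<close>. Matrix indices start at \<open>0\<close>, which
  causes the shift by \<open>Suc\<close>.
\<close>

lemma det_sum_outer_products:
  fixes u v :: "nat \<Rightarrow> nat \<Rightarrow> 'a::comm_ring_1"
  shows "det (mat s s (\<lambda>(p, q). \<Sum>i = 1..s. u i p * v i q)) =
    det (mat s s (\<lambda>(i, p). u (Suc i) p)) * det (mat s s (\<lambda>(i, q). v (Suc i) q))"
proof -
  let ?A = "mat s s (\<lambda>(i, p). u (Suc i) p)" and ?B = "mat s s (\<lambda>(i, q). v (Suc i) q)"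
  have "mat s s (\<lambda>(p, q). \<Sum>i = 1..s. u i p * v i q) = transpose_mat ?A * ?B"
  proof (rule eq_matI)
    fix p q assume "p < dim_row (transpose_mat ?A * ?B)" "q < dim_col (transpose_mat ?A * ?B)"
    then have pq: "p < s" "q < s" by auto
    have "(\<Sum>i = 1..s. u i p * v i q) = (\<Sum>i = 0..<s. u (Suc i) p * v (Suc i) q)"
      by (rule sum.reindex_bij_witness[of _ Suc "\<lambda>i. i - 1"]) auto
    then show "mat s s (\<lambda>(p, q). \<Sum>i = 1..s. u i p * v i q) $$ (p, q) =
        (transpose_mat ?A * ?B) $$ (p, q)"
      using pq by (simp add: scalar_prod_def)
  qed auto
  then show ?thesis by (simp add: det_mult[of _ s] det_transpose[of _ s])
qed

text \<open>
  Padding with zero vectors up to \<open>s\<close> summands puts a zero row into the first factor of the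
  factorization above. This bounds the rank over any commutative ring.
\<close>

lemma det_sum_few_outer_products:
  fixes u v :: "nat \<Rightarrow> nat \<Rightarrow> 'a::comm_ring_1"
  assumes "r < s"
  shows "det (mat s s (\<lambda>(p, q). \<Sum>i = 1..r. u i p * v i q)) = 0"
proof -
  define u' where "u' i p = (if i \<le> r then u i p else 0)" for i p
  have "(\<Sum>i = 1..r. u i p * v i q) = (\<Sum>i = 1..s. u' i p * v i q)" for p q
    using assms by (intro sum.mono_neutral_cong_left) (auto simp: u'_def)
  then have "det (mat s s (\<lambda>(p, q). \<Sum>i = 1..r. u i p * v i q)) =
      det (mat s s (\<lambda>(i, p). u' (Suc i) p)) * det (mat s s (\<lambda>(i, q). v (Suc i) q))"
    by (simp only: det_sum_outer_products)
  also have "det (mat s s (\<lambda>(i, p). u' (Suc i) p)) = 0"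
  proof -
    have "(\<Prod>i = 0..<s. mat s s (\<lambda>(i, p). u' (Suc i) p) $$ (i, \<pi> i)) = 0"
      if "\<pi> permutes {0..<s}" for \<pi>
    proof (rule prod_zero)
      have "\<pi> r < s" using that assms by (metis atLeastLessThan_iff permutes_in_image zero_le)
      \<comment> \<open>Row \<open>r\<close> belongs to the first padding vector, with number \<open>Suc r\<close>.\<close>
      then show "\<exists>i\<in>{0..<s}. mat s s (\<lambda>(i, p). u' (Suc i) p) $$ (i, \<pi> i) = 0"
        using assms by (intro bexI[of _ r]) (auto simp: u'_def)
    qed simp
    then show ?thesis by (simp add: det_def'[of _ s])
  qed
  finally show ?thesis by simp
qed

text \<open>
  A linear relation between the rows is a polynomial of degree less than \<open>s\<close> that vanishes at
  the \<open>s\<close> distinct nodes.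
\<close>

lemma vandermonde_det_nonzero:
  fixes z :: "nat \<Rightarrow> 'a::idom"
  assumes "inj_on z {..<s}"
  shows "det (mat s s (\<lambda>(i, p). z p ^ i)) \<noteq> 0"
proof
  let ?V = "mat s s (\<lambda>(i, p). z p ^ i)"
  assume "det ?V = 0"
  then have "det (transpose_mat ?V) = 0" by (simp add: det_transpose[of _ s])
  then obtain v where v: "v \<in> carrier_vec s" "v \<noteq> 0\<^sub>v s"
      "transpose_mat ?V *\<^sub>v v = 0\<^sub>v s"
    using det_0_iff_vec_prod_zero[of "transpose_mat ?V" s] by auto
  define f where "f = (\<Sum>i<s. monom (vec_index v i) i)"
  have coeff: "coeff f i = (if i < s then vec_index v i else 0)" for i
    by (simp add: f_def coeff_sum)
  have root: "poly f (z p) = 0" if "p < s" for p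
  proof -
    have "poly f (z p) = vec_index (transpose_mat ?V *\<^sub>v v) p"
      using that v(1)
      by (simp add: f_def poly_sum poly_monom scalar_prod_def lessThan_atLeast0 mult.commute)
    then show ?thesis using v(3) that by simp
  qed
  have "f \<noteq> 0"
  proof
    assume "f = 0"
    then have "v = 0\<^sub>v s" using coeff v(1) by (intro eq_vecI) (auto, metis coeff_0)
    with v(2) show False by simp
  qed
  have "degree f < s"
  proof (rule ccontr)
    assume "\<not> degree f < s"
    then have "coeff f (degree f) = 0" by (simp add: coeff)
    with \<open>f \<noteq> 0\<close> show False by simp
  qed
  moreover have "s \<le> card {x. poly f x = 0}"
    using card_mono[OF poly_roots_finite[OF \<open>f \<noteq> 0\<close>], of "z ` {..<s}"] root
      card_image[OF assms] by auto
  ultimately show False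
    using card_poly_roots_bound[OF \<open>f \<noteq> 0\<close>] by simp
qed

text \<open>
  A minor of the catalecticant matrix, whose rows and columns are selected by the
  exponents \<open>\<alpha>\<close> and \<open>\<beta>\<close>. The argument \<open>g\<close> stands for the coefficients of the form, divided by
  the multinomial coefficients; it may take values in the field or, for the generic sum of
  powers, in a polynomial ring.
\<close>

definition catalecticant ::
    "nat \<Rightarrow> (nat \<Rightarrow> nat \<Rightarrow>\<^sub>0 nat) \<Rightarrow> (nat \<Rightarrow> nat \<Rightarrow>\<^sub>0 nat) \<Rightarrow> ((nat \<Rightarrow>\<^sub>0 nat) \<Rightarrow> 'a) \<Rightarrow> 'a mat" where
  "catalecticant s \<alpha> \<beta> g = mat s s (\<lambda>(p, q). g (\<alpha> p + \<beta> q))"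

text \<open>
  Since \<open>c\<^bsup>\<alpha> + \<beta>\<^esup> = c\<^sup>\<alpha> c\<^sup>\<beta>\<close>, each linear form contributes an outer product to the
  catalecticant of a sum of powers.
\<close>

lemma det_catalecticant_power_sums:
  fixes c :: "nat \<Rightarrow> nat \<Rightarrow> 'a::comm_ring_1"
  shows "det (catalecticant s \<alpha> \<beta> (\<lambda>m. \<Sum>i = 1..s. form_monomial n (c i) m)) =
    det (mat s s (\<lambda>(i, p). form_monomial n (c (Suc i)) (\<alpha> p))) *
    det (mat s s (\<lambda>(i, p). form_monomial n (c (Suc i)) (\<beta> p)))"
  using det_sum_outer_products[of s "\<lambda>i p. form_monomial n (c i) (\<alpha> p)" "\<lambda>i p. form_monomial n (c i) (\<beta> p)"]
  by (simp add: catalecticant_def form_monomial_add)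

lemma det_catalecticant_few_power_sums:
  fixes c :: "nat \<Rightarrow> nat \<Rightarrow> 'a::comm_ring_1"
  assumes "r < s"
  shows "det (catalecticant s \<alpha> \<beta> (\<lambda>m. \<Sum>i = 1..r. form_monomial n (c i) m)) = 0"
  using det_sum_few_outer_products[OF assms, of "\<lambda>i p. form_monomial n (c i) (\<alpha> p)" "\<lambda>i p. form_monomial n (c i) (\<beta> p)"]
  by (simp add: catalecticant_def form_monomial_add)

text \<open>
  The sum itself shows that the rank is at most \<open>s\<close>. A second expression as a sum of \<open>r\<close>
  powers has the same power sums and hence the same catalecticant, whose minor would vanish
  if \<open>r < s\<close>.
\<close>

lemma waring_rank_eq_if_catalecticant_det_nonzero:
  fixes c :: "nat \<Rightarrow> nat \<Rightarrow> 'a::{field_char_0}"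
  assumes \<alpha>: "\<And>p. p < s \<Longrightarrow> \<alpha> p \<in> exponents n k"
    and \<beta>: "\<And>q. q < s \<Longrightarrow> \<beta> q \<in> exponents n l"
    and nz: "det (catalecticant s \<alpha> \<beta> (\<lambda>m. \<Sum>i = 1..s. form_monomial n (c i) m)) \<noteq> 0"
  shows "waring_rank n (k + l) (\<Sum>i = 1..s. linear_form n (c i) ^ (k + l)) = s"
  unfolding waring_rank_def
proof (rule Least_equality)
  show "\<exists>L. (\<forall>i\<in>{1..s}. L i \<in> linear_forms n) \<and>
      (\<Sum>i = 1..s. linear_form n (c i) ^ (k + l)) = (\<Sum>i = 1..s. L i ^ (k + l))"
    by (rule exI[of _ "\<lambda>i. linear_form n (c i)"]) (auto simp: linear_forms_def)
next
  fix r :: nat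
  assume "\<exists>L. (\<forall>i\<in>{1..r}. L i \<in> linear_forms n) \<and>
      (\<Sum>i = 1..s. linear_form n (c i) ^ (k + l)) = (\<Sum>i = 1..r. L i ^ (k + l))"
  then obtain L where L: "\<forall>i\<in>{1..r}. \<exists>b. L i = linear_form n b"
    and sum_L: "(\<Sum>i = 1..s. linear_form n (c i) ^ (k + l)) = (\<Sum>i = 1..r. L i ^ (k + l))"
    by (auto simp: linear_forms_def)
  from L obtain b where b: "\<forall>i\<in>{1..r}. L i = linear_form n (b i)" by metis
  have eq: "(\<Sum>i = 1..s. linear_form n (c i) ^ (k + l)) = (\<Sum>i = 1..r. linear_form n (b i) ^ (k + l))"
    unfolding sum_L by (intro sum.cong) (use b in auto)
  have "catalecticant s \<alpha> \<beta> (\<lambda>m. \<Sum>i = 1..s. form_monomial n (c i) m) =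
      catalecticant s \<alpha> \<beta> (\<lambda>m. \<Sum>i = 1..r. form_monomial n (b i) m)"
    unfolding catalecticant_def
    using power_sums_eq_of_Waring_eq[OF eq exponents_add[OF \<alpha> \<beta>]]
    by (intro cong_mat) (simp_all del: One_nat_def)
  with nz det_catalecticant_few_power_sums[of r s \<alpha> \<beta> n b] show "s \<le> r"
    by (metis not_le)
qed

section \<open>Monomials and their separation by a single point\<close>

lemma base_expansion_less:
  fixes f :: "nat \<Rightarrow> nat"
  assumes "\<And>j. j < n \<Longrightarrow> f j < B"
  shows "(\<Sum>j<n. f j * B ^ j) < B ^ n"
  using assms
proof (induction n)
  case (Suc n)
  have "(\<Sum>j<n. f j * B ^ j) < B ^ n" by (rule Suc.IH) (simp add: Suc.prems)
  moreover have "Suc (f n) * B ^ n \<le> B * B ^ n"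
    using Suc.prems[of n] by (intro mult_right_mono) auto
  ultimately show ?case by simp
qed simp

lemma base_expansion_unique:
  fixes f g :: "nat \<Rightarrow> nat"
  assumes "\<And>j. j < n \<Longrightarrow> f j < B" "\<And>j. j < n \<Longrightarrow> g j < B"
    and "(\<Sum>j<n. f j * B ^ j) = (\<Sum>j<n. g j * B ^ j)"
    and "j < n"
  shows "f j = g j"
  using assms
proof (induction n)
  case (Suc n)
  let ?F = "\<Sum>j<n. f j * B ^ j" and ?G = "\<Sum>j<n. g j * B ^ j"
  have lt: "?F < B ^ n" "?G < B ^ n"
    by (rule base_expansion_less, simp add: Suc.prems)+
  have eq: "?F + f n * B ^ n = ?G + g n * B ^ n" using Suc.prems(3) by simp
  have "B ^ n > 0" using lt(1) by linarith
  have "f n = (?F + f n * B ^ n) div B ^ n" using lt \<open>B ^ n > 0\<close> by simp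
  also have "\<dots> = g n" unfolding eq using lt \<open>B ^ n > 0\<close> by simp
  finally have top: "f n = g n" .
  with eq have "?F = ?G" by simp
  show ?case
  proof (cases "j = n")
    case False
    then show ?thesis using Suc.IH \<open>?F = ?G\<close> Suc.prems by simp
  qed (simp add: top)
qed simp

text \<open>
  The value of \<open>X\<^sup>m\<close> at this point is \<open>2\<^sup>w\<close>, where \<open>w\<close> is the number with base \<open>d + 1\<close>
  digits \<open>m\<^sub>1, \<dots>, m\<^sub>n\<close>. Variables are numbered from \<open>1\<close> and digits from \<open>0\<close>.
\<close>

definition separating_point :: "nat \<Rightarrow> nat \<Rightarrow> 'a::semiring_1" where
  "separating_point d j = 2 ^ (Suc d ^ (j - 1))"

lemma form_monomial_separating_point:
  "form_monomial n (separating_point d) m =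
    2 ^ (\<Sum>j<n. Poly_Mapping.lookup m (Suc j) * Suc d ^ j)"
proof -
  have "form_monomial n (separating_point d) m =
      (\<Prod>j<n. separating_point d (Suc j) ^ Poly_Mapping.lookup m (Suc j))"
    unfolding form_monomial_def
    by (rule prod.reindex_bij_witness[of _ Suc "\<lambda>i. i - 1"]) auto
  then show ?thesis
    by (simp add: separating_point_def power_sum mult.commute flip: power_mult)
qed

lemma exponents_lookup_le:
  assumes "m \<in> exponents n k"
  shows "Poly_Mapping.lookup m j \<le> k"
proof (cases "j \<in> {1..n}")
  case True
  then show ?thesis
    using assms member_le_sum[of j "{1..n}" "Poly_Mapping.lookup m"] by (auto simp: exponents_def)
next
  case False
  then have "j \<notin> Poly_Mapping.keys m" using assms by (auto simp: exponents_def)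
  then show ?thesis by (simp add: in_keys_iff)
qed

lemma inj_on_form_monomial_separating_point:
  assumes "k \<le> d"
  shows "inj_on (form_monomial n (separating_point d :: nat \<Rightarrow> 'a::field_char_0)) (exponents n k)"
proof (rule inj_onI)
  fix m m' assume m: "m \<in> exponents n k" and m': "m' \<in> exponents n k"
  let ?w = "\<lambda>m. \<Sum>j<n. Poly_Mapping.lookup m (Suc j) * Suc d ^ j"
  assume "form_monomial n (separating_point d :: nat \<Rightarrow> 'a) m = form_monomial n (separating_point d) m'"
  then have "(of_nat (2 ^ ?w m) :: 'a) = of_nat (2 ^ ?w m')"
    by (simp add: form_monomial_separating_point)
  then have "(2::nat) ^ ?w m = 2 ^ ?w m'" by (simp only: of_nat_eq_iff)
  then have w: "?w m = ?w m'" by simp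
  have lt: "Poly_Mapping.lookup a j < Suc d" if "a \<in> exponents n k" for a j
    using exponents_lookup_le[OF that, of j] assms by simp
  have "Poly_Mapping.lookup m (Suc j) = Poly_Mapping.lookup m' (Suc j)" if "j < n" for j
    using base_expansion_unique[OF lt lt w that] m m' by blast
  moreover have "\<exists>i<n. j = Suc i" if "j \<in> {1..n}" for j
    using that by (intro exI[of _ "j - 1"]) auto
  ultimately have "Poly_Mapping.lookup m j = Poly_Mapping.lookup m' j" if "j \<in> {1..n}" for j
    using that by metis
  moreover have "Poly_Mapping.lookup m j = Poly_Mapping.lookup m' j" if "j \<notin> {1..n}" for j
  proof -
    have "j \<notin> Poly_Mapping.keys m" "j \<notin> Poly_Mapping.keys m'"
      using that m m' by (auto simp: exponents_def)
    then show ?thesis by (simp add: in_keys_iff)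
  qed
  ultimately show "m = m'" by (intro poly_mapping_eqI) blast
qed

text \<open>
  Exponents of degree \<open>h\<close> in \<open>n\<close> variables correspond to lists of \<open>n\<close> natural numbers with
  sum \<open>h\<close>, and there are as many of these as the binomial coefficient says.
\<close>

lemma obtain_exponents:
  assumes "n \<ge> 1" "s \<le> (h + n - 1) choose (n - 1)"
  obtains \<alpha> where "inj_on \<alpha> {..<s}" "\<And>p. p < s \<Longrightarrow> \<alpha> p \<in> exponents n h"
proof -
  let ?W = "{l :: nat list. length l = n \<and> sum_list l = h}"
  define E where "E l = (\<Sum>j = 1..n. Poly_Mapping.single j (l ! (j - 1)))" for l :: "nat list"
  have lookup_E: "Poly_Mapping.lookup (E l) j = (if j \<in> {1..n} then l ! (j - 1) else 0)" for l j
    by (simp add: E_def lookup_sum lookup_single when_def)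
  have "(\<Sum>j = 1..n. Poly_Mapping.lookup (E l) j) = sum_list l" if "length l = n" for l
  proof -
    have "(\<Sum>j = 1..n. Poly_Mapping.lookup (E l) j) = (\<Sum>i = 0..<n. l ! i)"
      by (rule sum.reindex_bij_witness[of _ Suc "\<lambda>i. i - 1"]) (auto simp: lookup_E)
    then show ?thesis using that by (simp add: sum_list_sum_nth)
  qed
  then have E_exponents: "E l \<in> exponents n h" if "l \<in> ?W" for l
    using that by (auto simp: exponents_def in_keys_iff lookup_E split: if_splits)
  have inj_E: "inj_on E ?W"
  proof (rule inj_onI)
    fix l l' assume l: "l \<in> ?W" "l' \<in> ?W" "E l = E l'"
    show "l = l'"
    proof (rule nth_equalityI)
      fix i assume "i < length l"
      then have "Suc i \<in> {1..n}" using l by simp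
      then show "l ! i = l' ! i" using lookup_E[of l "Suc i"] lookup_E[of l' "Suc i"] l(3) by simp
    qed (use l in simp)
  qed
  have "(h + n - 1) choose h = (h + n - 1) choose (n - 1)"
    using assms(1) binomial_symmetric[of h "h + n - 1"] by simp
  then have "card {..<s} \<le> card ?W"
    using assms(2) by (simp add: card_length_sum_list)
  moreover have "finite ?W"
    by (rule finite_subset[OF _ finite_lists_length_eq[of "{..h}" n]])
      (auto dest: member_le_sum_list)
  ultimately obtain w where w: "inj_on w {..<s}" "w ` {..<s} \<subseteq> ?W"
    using card_le_inj[of "{..<s}" ?W] by blast
  show thesis
  proof
    show "inj_on (E \<circ> w) {..<s}"
      using w inj_on_subset[OF inj_E w(2)] by (rule_tac comp_inj_on)
    show "(E \<circ> w) p \<in> exponents n h" if "p < s" for p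
      using E_exponents w(2) that by auto
  qed
qed

section \<open>The Waring rank of a general sum of powers\<close>

text \<open>
  The power sum \<open>\<Sum>i. c\<^sub>i\<^sup>m\<close> of the generic forms, as a polynomial in their coefficients:
  the variable \<open>(i, j)\<close> is the coefficient of \<open>X\<^sub>j\<close> in the \<open>i\<close>-th form.
\<close>

definition power_sum_poly :: "nat \<Rightarrow> nat \<Rightarrow> (nat \<Rightarrow>\<^sub>0 nat) \<Rightarrow> (nat \<times> nat, 'a::comm_ring_1) mpoly" where
  "power_sum_poly s n m = (\<Sum>i = 1..s. form_monomial n (\<lambda>j. Var (i, j)) m)"

lemma power_sum_poly_in: "power_sum_poly s n m \<in> mpolys_in ({1..s} \<times> {1..n})"
  unfolding power_sum_poly_def form_monomial_def
  by (intro mpolys_in_sum mpolys_in_prod mpolys_in_power mpolys_in_Var) auto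

lemma eval_power_sum_poly:
  "eval_mpoly a (power_sum_poly s n m) = (\<Sum>i = 1..s. form_monomial n (\<lambda>j. a (i, j)) m)"
proof -
  interpret comm_ring_hom "eval_mpoly a" by (rule eval_mpoly_hom)
  show ?thesis
    by (simp add: power_sum_poly_def form_monomial_def hom_distribs eval_mpoly_Var)
qed

lemma eval_det_catalecticant:
  fixes a :: "nat \<times> nat \<Rightarrow> 'a::comm_ring_1"
  shows "eval_mpoly a (det (catalecticant s \<alpha> \<beta> (power_sum_poly s n))) =
    det (catalecticant s \<alpha> \<beta> (\<lambda>m. \<Sum>i = 1..s. form_monomial n (\<lambda>j. a (i, j)) m))"
proof -
  interpret comm_ring_hom "eval_mpoly a" by (rule eval_mpoly_hom)
  have "map_mat (eval_mpoly a) (catalecticant s \<alpha> \<beta> (power_sum_poly s n)) =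
      catalecticant s \<alpha> \<beta> (\<lambda>m. \<Sum>i = 1..s. form_monomial n (\<lambda>j. a (i, j)) m)"
    by (intro eq_matI) (auto simp: catalecticant_def eval_power_sum_poly)
  then show ?thesis by (metis hom_det)
qed

text \<open>
  Raising all coordinates of a point to the \<open>i\<close>-th power does the same to the values of
  monomials, which turns the matrix into a Vandermonde matrix.
\<close>

lemma det_powers_of_separating_point_nonzero:
  assumes "k \<le> d" "inj_on \<alpha> {..<s}" "\<And>p. p < s \<Longrightarrow> \<alpha> p \<in> exponents n k"
  shows "det (mat s s (\<lambda>(i, p).
    form_monomial n (\<lambda>j. (separating_point d j :: 'a::field_char_0) ^ i) (\<alpha> p))) \<noteq> 0"
proof -
  have "form_monomial n (\<lambda>j. (separating_point d j :: 'a) ^ i) m =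
      form_monomial n (separating_point d) m ^ i" for i m
    by (simp add: form_monomial_def prod_power_distrib power_mult[symmetric] mult.commute)
  moreover have "inj_on (\<lambda>p. form_monomial n (separating_point d :: nat \<Rightarrow> 'a) (\<alpha> p)) {..<s}"
    using comp_inj_on[OF assms(2) inj_on_subset[OF inj_on_form_monomial_separating_point[OF assms(1)]]]
      assms(3) by (auto simp: comp_def image_subset_iff)
  ultimately show ?thesis using vandermonde_det_nonzero by simp
qed

theorem corollary3p4:
  fixes d s n :: nat
  assumes "d \<ge> 1" and "s \<ge> 1" and "n \<ge> 2"
    and "s \<le> (d div 2 + n - 1) choose (n - 1)"
  shows "holds_for_general ({1..s} \<times> {1..n})
    (\<lambda>a :: nat \<times> nat \<Rightarrow> 'a::{alg_closed_field, field_char_0}.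
       waring_rank n d (\<Sum>i = 1..s. linear_form n (\<lambda>j. a (i, j)) ^ d) = s)"
proof -
  let ?I = "{1..s} \<times> {1..n}"
  define h where "h = d div 2"
  obtain \<alpha> where \<alpha>: "inj_on \<alpha> {..<s}" "\<And>p. p < s \<Longrightarrow> \<alpha> p \<in> exponents n h"
    using obtain_exponents[of n s h] assms(3,4) unfolding h_def by auto
  \<comment> \<open>The factor \<open>X\<^sub>1\<close> appears for odd \<open>d\<close>: the column exponents then have degree \<open>h + 1\<close>.\<close>
  define \<beta> where "\<beta> p = \<alpha> p + Poly_Mapping.single 1 (d - 2 * h)" for p
  have "Poly_Mapping.single 1 (d - 2 * h) \<in> exponents n (d - 2 * h)"
    using assms(3) by (auto simp: exponents_def lookup_single when_def)
  moreover have h: "h + (d - 2 * h) = d - h" by (simp add: h_def)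
  ultimately have \<beta>_exponents: "\<beta> p \<in> exponents n (d - h)" if "p < s" for p
    using exponents_add[OF \<alpha>(2)[OF that]] h unfolding \<beta>_def by fastforce
  have inj_\<beta>: "inj_on \<beta> {..<s}"
    using \<alpha>(1) by (simp add: \<beta>_def inj_on_def)
  define D :: "(nat \<times> nat, 'a) mpoly" where "D = det (catalecticant s \<alpha> \<beta> (power_sum_poly s n))"
  let ?U = "{a \<in> affine_space ?I. eval_mpoly a D \<noteq> 0}"
  have "D \<in> mpolys_in ?I"
    unfolding D_def
    by (rule mpolys_in_det[of _ s]) (simp_all only: catalecticant_def power_sum_poly_in mat_carrier
        index_mat prod.case)
  then have "zariski_open ?I ?U" by (rule zariski_open_nonvanishing)
  moreover have "?U \<noteq> {}"
  proof -
    define a :: "nat \<times> nat \<Rightarrow> 'a" where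
      "a = restrict (\<lambda>(i, j). separating_point d j ^ (i - 1)) ?I"
    have "form_monomial n (\<lambda>j. a (Suc i, j)) m = form_monomial n (\<lambda>j. separating_point d j ^ i) m"
      if "i < s" for i m
      unfolding form_monomial_def using that by (intro prod.cong) (auto simp: a_def)
    then have "mat s s (\<lambda>(i, p). form_monomial n (\<lambda>j. a (Suc i, j)) (\<gamma> p)) =
        mat s s (\<lambda>(i, p). form_monomial n (\<lambda>j. separating_point d j ^ i) (\<gamma> p))" for \<gamma>
      by (intro cong_mat) auto
    moreover have "h \<le> d" by (simp add: h_def)
    ultimately have "eval_mpoly a D \<noteq> 0"
      unfolding D_def eval_det_catalecticant
        det_catalecticant_power_sums[where c = "\<lambda>i j. a (i, j)"]
      using det_powers_of_separating_point_nonzero[OF _ \<alpha>, where d = d and 'a = 'a]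
        det_powers_of_separating_point_nonzero[OF _ inj_\<beta> \<beta>_exponents, where d = d and 'a = 'a]
      by simp
    moreover have "a \<in> affine_space ?I" by (auto simp: affine_space_def a_def)
    ultimately show ?thesis by blast
  qed
  moreover have "waring_rank n d (\<Sum>i = 1..s. linear_form n (\<lambda>j. a (i, j)) ^ d) = s"
    if "a \<in> ?U" for a
  proof -
    have "h + (d - h) = d" by (simp add: h_def)
    then show ?thesis
      using waring_rank_eq_if_catalecticant_det_nonzero[OF \<alpha>(2) \<beta>_exponents, where c = "\<lambda>i j. a (i, j)"]
        that by (simp add: D_def eval_det_catalecticant)
  qed
  ultimately show ?thesis
    unfolding holds_for_general_def by blast
qed

end
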